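(* Let $A$ be a finite alphabet, $A^+$ the set of non-empty words over $A$, $H=\sum_{w\in A^+}H_{(w)}$, and $$P=\log(1+H)=\sum_{n=1}^{\infty}\frac{(-1)^{n-1}}{n}H^n .$$ In the basis of complete homogeneous functions, $$P=\sum_{I\ne1}\frac{(-1)^{\ell(I)-1}}{\ell(I)}H_I,$$ where the sum is over all non-empty sentences $I$ over $A$; moreover the series $P$ is primitive with respect to the pruning coproduct: $$\Delta(P)=1\otimes P+P\otimes1 .$$
   Context: $\Bbbk$ is a field of characteristic zero. A sentence $I=(w_1,\dots,w_m)$ over $A$ is a finite sequence of non-empty words in letters of $A$; $\ell(I)=m$; $1$ is the empty sentence; $I\cdot J$ is concatenation of sequences of words. $\mathrm{NSym}_A$ is the Hopf algebra over $\Bbbk$ with linear basis $(H_I)$ (complete homogeneous functions) indexed by sentences, graded by the total number of letters, with $H_1=1$, product $H_IH_J=H_{I\cdot J}$, and (pruning) coproduct the algebra morphism $\Delta$ determined by $\Delta(H_{(w)})=\sum_{uv=w}H_{(u)}\otimes H_{(v)}$ for words $w$ (sum over all factorizations into a possibly empty prefix $u$ and suffix $v$, with $H_{(1)}=1$ for the empty word). A formal series is a possibly infinite combination $G=\sum_I g_IH_I$ with $g_I\in\Bbbk$. Products of series are Cauchy products extending the product of $\mathrm{NSym}_A$; the coproduct is extended by $\Delta(G)=\sum_Ig_I\Delta(H_I)$, understood coefficientwise as a formal series in the elements $H_J\otimes H_K$, and $G_1\otimes G_2$ for series is understood coefficientwise. *)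

theory Defs
  imports Complex_Main "HOL-Library.Poly_Mapping" "HOL-Library.Product_Plus" "HOL-Library.Multiset"
begin

section \<open>Sentences\<close>

typedef 'a sentence = "{I :: 'a list list. [] \<notin> set I}"
  morphisms words Sentence
  by (rule exI[of _ "[]"]) simp

setup_lifting type_definition_sentence

text \<open>
  Concatenation of sentences is written additively, because \<open>Poly_Mapping\<close> builds the
  convolution product from a (not necessarily commutative) \<open>monoid_add\<close> of indices.
  The empty sentence, usually written \<open>1\<close>, is therefore \<open>0 :: 'a sentence\<close>.
\<close>

instantiation sentence :: (type) monoid_add
begin

lift_definition zero_sentence :: "'a sentence" is "[]" by simp

lift_definition plus_sentence :: "'a sentence \<Rightarrow> 'a sentence \<Rightarrow> 'a sentence" is "(@)" by simp

instance
  by standard (transfer; simp)+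

end

lift_definition sent_length :: "'a sentence \<Rightarrow> nat" is length .

text \<open>The one-word sentence \<open>(w)\<close>; the empty word is sent to the empty sentence.\<close>

lift_definition one_word :: "'a list \<Rightarrow> 'a sentence" is "\<lambda>w. if w = [] then [] else [w]"
  by simp

definition nonempty_words :: "'a set \<Rightarrow> 'a list set" where
  "nonempty_words A = lists A - {[]}"

definition sentences :: "'a set \<Rightarrow> 'a sentence set" where
  "sentences A = {I. set (words I) \<subseteq> nonempty_words A}"


section \<open>The Hopf algebra of coloured noncommutative symmetric functions\<close>

text \<open>
  The algebra is formed over all sentences with letters in \<open>'a\<close>; for an alphabet \<open>A :: 'a set\<close>,
  \<open>NSym\<^sub>A\<close> is the span of the \<open>H\<^sub>I\<close> with \<open>I \<in> sentences A\<close>. The tensor square is identified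
  with the finitely supported functions on pairs of sentences, whose convolution product
  is the componentwise product of tensors. In both algebras, \<open>Poly_Mapping.single 0 c\<close> is the scalar \<open>c\<close>.
\<close>

type_synonym ('a, 'k) nsym = "'a sentence \<Rightarrow>\<^sub>0 'k"
type_synonym ('a, 'k) nsym2 = "('a sentence \<times> 'a sentence) \<Rightarrow>\<^sub>0 'k"

definition nsym_H :: "'a sentence \<Rightarrow> ('a, 'k::field) nsym" where
  "nsym_H I = Poly_Mapping.single I 1"

definition tensor :: "('a, 'k::field) nsym \<Rightarrow> ('a, 'k) nsym \<Rightarrow> ('a, 'k) nsym2" where
  "tensor x y = (\<Sum>J\<in>Poly_Mapping.keys x. \<Sum>K\<in>Poly_Mapping.keys y.
     Poly_Mapping.single (J, K) (Poly_Mapping.lookup x J * Poly_Mapping.lookup y K))"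

definition coprod_word :: "'a list \<Rightarrow> ('a, 'k::field) nsym2" where
  "coprod_word w = (\<Sum>(u, v)\<in>{(u, v). u @ v = w}. tensor (nsym_H (one_word u)) (nsym_H (one_word v)))"

definition coprod :: "('a, 'k::field) nsym \<Rightarrow> ('a, 'k) nsym2" where
  "coprod x = (\<Sum>I\<in>Poly_Mapping.keys x.
     Poly_Mapping.single 0 (Poly_Mapping.lookup x I) * prod_list (map coprod_word (words I)))"

lemma nsym_H_0: "nsym_H 0 = 1"
  by (simp add: nsym_H_def)

lemma nsym_H_mult: "nsym_H I * nsym_H J = nsym_H (I + J)"
  by (simp add: nsym_H_def mult_single)

lemma tensor_nsym_H: "tensor (nsym_H J) (nsym_H K) = Poly_Mapping.single (J, K) 1"
  by (simp add: tensor_def nsym_H_def)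

lemma coprod_nsym_H: "coprod (nsym_H I) = prod_list (map coprod_word (words I))"
  by (simp add: coprod_def nsym_H_def)

lemma coprod_nsym_H_word: "coprod (nsym_H (one_word w)) = coprod_word w"
proof (cases "w = []")
  case True
  have "{(u, v). u @ v = ([] :: 'a list)} = {([], [])}" by auto
  moreover have "one_word ([] :: 'a list) = 0" by transfer simp
  ultimately show ?thesis using True
    by (simp add: coprod_nsym_H zero_sentence.rep_eq coprod_word_def tensor_nsym_H
        flip: zero_prod_def)
next
  case False
  then show ?thesis by (simp add: coprod_nsym_H one_word.rep_eq)
qed

lemma coprod_superset:
  assumes "finite S" "Poly_Mapping.keys x \<subseteq> S"
  shows "coprod x = (\<Sum>I\<in>S. Poly_Mapping.single 0 (Poly_Mapping.lookup x I) * coprod (nsym_H I))"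
  unfolding coprod_nsym_H unfolding coprod_def
  by (rule sum.mono_neutral_left) (use assms in \<open>auto simp: in_keys_iff\<close>)

lemma coprod_add: "coprod (x + y) = coprod x + coprod y"
proof -
  let ?S = "Poly_Mapping.keys x \<union> Poly_Mapping.keys y"
  have "Poly_Mapping.keys (x + y) \<subseteq> ?S" by (rule Poly_Mapping.keys_add)
  then show ?thesis
    by (simp add: coprod_superset[of ?S] lookup_add single_add distrib_right sum.distrib)
qed

lemma coprod_sum: "coprod (sum f S) = (\<Sum>i\<in>S. coprod (f i))"
  by (induction S rule: infinite_finite_induct) (simp_all add: coprod_add, simp_all add: coprod_def)

lemma coprod_single: "coprod (Poly_Mapping.single I c) = Poly_Mapping.single 0 c * coprod (nsym_H I)"
  by (subst coprod_superset[of "{I}"]) auto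

lemma poly_mapping_sum_monomials:
  "(\<Sum>k\<in>Poly_Mapping.keys x. Poly_Mapping.single k (Poly_Mapping.lookup x k)) = x"
proof (rule poly_mapping_eqI)
  fix j
  have "(\<Sum>k\<in>Poly_Mapping.keys x. Poly_Mapping.lookup x k when k = j) = Poly_Mapping.lookup x j"
    by (simp add: when_def in_keys_iff)
  then show "Poly_Mapping.lookup (\<Sum>k\<in>Poly_Mapping.keys x. Poly_Mapping.single k (Poly_Mapping.lookup x k)) j
      = Poly_Mapping.lookup x j"
    by (simp add: lookup_sum lookup_single)
qed

lemma single_0_commute:
  fixes x :: "'m::monoid_add \<Rightarrow>\<^sub>0 'k::comm_semiring_1"
  shows "Poly_Mapping.single 0 c * x = x * Poly_Mapping.single 0 c"
proof -
  have "x = (\<Sum>k\<in>Poly_Mapping.keys x. Poly_Mapping.single k (Poly_Mapping.lookup x k))"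
    by (simp add: poly_mapping_sum_monomials)
  then obtain g where x: "x = (\<Sum>k\<in>Poly_Mapping.keys x. Poly_Mapping.single k (g k))"
    by blast
  show ?thesis
    by (subst (1 2) x) (simp add: sum_distrib_left sum_distrib_right mult_single mult.commute)
qed

text \<open>\<open>coprod\<close> is a morphism of algebras; it is determined by \<open>coprod_nsym_H_word\<close>.\<close>

lemma coprod_1: "coprod 1 = 1"
  by (simp add: coprod_nsym_H zero_sentence.rep_eq flip: nsym_H_0)

lemma coprod_scale: "coprod (Poly_Mapping.single 0 c * x) = Poly_Mapping.single 0 c * coprod x"
proof -
  have "x = (\<Sum>k\<in>Poly_Mapping.keys x. Poly_Mapping.single k (Poly_Mapping.lookup x k))"
    by (simp add: poly_mapping_sum_monomials)
  then obtain g where x: "x = (\<Sum>k\<in>Poly_Mapping.keys x. Poly_Mapping.single k (g k))"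
    by blast
  show ?thesis
    by (subst (1 2) x) (simp add: coprod_sum sum_distrib_left mult_single coprod_single mult.assoc[symmetric])
qed

lemma coprod_mult: "coprod (x * y) = coprod x * coprod y"
proof -
  have H: "coprod (nsym_H (I + J)) = coprod (nsym_H I) * coprod (nsym_H J)" for I J
    by (simp add: coprod_nsym_H plus_sentence.rep_eq)
  have S: "coprod (Poly_Mapping.single (I + J) (c * d))
      = coprod (Poly_Mapping.single I c) * coprod (Poly_Mapping.single J d)" for I J c d
  proof -
    have "coprod (Poly_Mapping.single (I + J) (c * d))
        = Poly_Mapping.single 0 c * (Poly_Mapping.single 0 d * coprod (nsym_H I)) * coprod (nsym_H J)"
      by (simp add: coprod_single[of "I + J"] H mult_single mult.assoc[symmetric])
    also have "\<dots> = Poly_Mapping.single 0 c * coprod (nsym_H I)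
        * (Poly_Mapping.single 0 d * coprod (nsym_H J))"
      by (simp only: single_0_commute[of d "coprod (nsym_H I)"] mult.assoc)
    finally show ?thesis by (simp add: coprod_single[of I] coprod_single[of J])
  qed
  obtain g h where x: "x = (\<Sum>k\<in>Poly_Mapping.keys x. Poly_Mapping.single k (g k))"
    and y: "y = (\<Sum>k\<in>Poly_Mapping.keys y. Poly_Mapping.single k (h k))"
    by (metis poly_mapping_sum_monomials)
  show ?thesis
    by (subst (1 2) x, subst (1 2) y)
      (simp add: sum_product coprod_sum mult_single S)
qed


section \<open>Formal series\<close>

text \<open>
  Formal series in the \<open>H\<^sub>I\<close> (with \<open>'m = 'a sentence\<close>) and in the tensors of two basis elements
  (with \<open>'m = 'a sentence \<times> 'a sentence\<close>) are arbitrary families of coefficients; finite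
  combinations embed by \<open>Poly_Mapping.lookup\<close>.
\<close>

type_synonym ('m, 'k) series = "'m \<Rightarrow> 'k"

text \<open>
  Infinite sums of series are taken coefficientwise. They are meaningful when every
  coefficient receives only finitely many nonzero contributions; outside that case the value
  is junk. The \<open>series_summable\<close> lemmas below show that every sum in use is of the meaningful kind.
\<close>

definition series_summable :: "('i \<Rightarrow> ('m, 'k::field) series) \<Rightarrow> 'i set \<Rightarrow> bool" where
  "series_summable F S \<longleftrightarrow> (\<forall>m. finite {i\<in>S. F i m \<noteq> 0})"

definition series_sum :: "('i \<Rightarrow> ('m, 'k::field) series) \<Rightarrow> 'i set \<Rightarrow> ('m, 'k) series" where
  "series_sum F S = (\<lambda>m. \<Sum>i\<in>{i\<in>S. F i m \<noteq> 0}. F i m)"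

definition series_one :: "('m::monoid_add, 'k::field) series" where
  "series_one = Poly_Mapping.lookup 1"

definition series_add :: "('m, 'k::field) series \<Rightarrow> ('m, 'k) series \<Rightarrow> ('m, 'k) series" where
  "series_add F G = (\<lambda>m. F m + G m)"

definition series_scale :: "'k::field \<Rightarrow> ('m, 'k) series \<Rightarrow> ('m, 'k) series" where
  "series_scale c F = (\<lambda>m. c * F m)"

definition series_mult ::
    "('a sentence, 'k::field) series \<Rightarrow> ('a sentence, 'k) series \<Rightarrow> ('a sentence, 'k) series" where
  "series_mult F G = (\<lambda>I. \<Sum>(J, K)\<in>{(J, K). J + K = I}. F J * G K)"

primrec series_power ::
    "('a sentence, 'k::field) series \<Rightarrow> nat \<Rightarrow> ('a sentence, 'k) series" where
  "series_power F 0 = series_one"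
| "series_power F (Suc n) = series_mult F (series_power F n)"

definition series_log1p :: "('a sentence, 'k::field) series \<Rightarrow> ('a sentence, 'k) series" where
  "series_log1p F =
     series_sum (\<lambda>n. series_scale ((-1) ^ (n - 1) / of_nat n) (series_power F n)) {1..}"

definition series_tensor ::
    "('a sentence, 'k::field) series \<Rightarrow> ('a sentence, 'k) series
      \<Rightarrow> ('a sentence \<times> 'a sentence, 'k) series" where
  "series_tensor F G = (\<lambda>(J, K). F J * G K)"

definition series_coprod ::
    "('a sentence, 'k::field) series \<Rightarrow> ('a sentence \<times> 'a sentence, 'k) series" where
  "series_coprod G =
     series_sum (\<lambda>I. series_scale (G I) (Poly_Mapping.lookup (coprod (nsym_H I)))) UNIV"

definition series_H :: "'a set \<Rightarrow> ('a sentence, 'k::field) series" where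
  "series_H A = series_sum (\<lambda>w. Poly_Mapping.lookup (nsym_H (one_word w))) (nonempty_words A)"

definition series_P :: "'a set \<Rightarrow> ('a sentence, 'k::field) series" where
  "series_P A = series_log1p (series_H A)"


subsection \<open>Well-definedness\<close>

lemma finite_splittings: "finite {(J, K). J + K = (I :: 'a sentence)}"
proof (rule finite_imageD)
  have "(\<lambda>(J, K). (words J, words K)) ` {(J, K). J + K = I}
      \<subseteq> (\<lambda>n. (take n (words I), drop n (words I))) ` {..length (words I)}"
  proof (rule image_subsetI)
    fix p assume "p \<in> {(J, K). J + K = I}"
    then have "words I = words (fst p) @ words (snd p)"
      by (auto simp: plus_sentence.rep_eq[symmetric])
    then show "(case p of (J, K) \<Rightarrow> (words J, words K))
        \<in> (\<lambda>n. (take n (words I), drop n (words I))) ` {..length (words I)}"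
      by (intro image_eqI[of _ _ "length (words (fst p))"]) (auto simp: split_beta)
  qed
  then show "finite ((\<lambda>(J, K). (words J, words K)) ` {(J, K). J + K = I})"
    by (rule finite_subset) simp
  show "inj_on (\<lambda>(J, K). (words J, words K)) {(J, K). J + K = I}"
    by (auto simp: inj_on_def words_inject)
qed

lemma finite_factorizations: "finite {(u, v). u @ v = (w :: 'a list)}"
proof (rule finite_subset)
  show "{(u, v). u @ v = w} \<subseteq> (\<lambda>n. (take n w, drop n w)) ` {..length w}"
  proof
    fix p assume "p \<in> {(u, v). u @ v = w}"
    then show "p \<in> (\<lambda>n. (take n w, drop n w)) ` {..length w}"
      by (intro image_eqI[of _ _ "length (fst p)"]) auto
  qed
qed simp

lemma series_mult_lookup:
  fixes x y :: "('a, 'k::field) nsym"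
  shows "series_mult (Poly_Mapping.lookup x) (Poly_Mapping.lookup y) = Poly_Mapping.lookup (x * y)"
proof
  fix I :: "'a sentence"
  obtain g h where x: "x = (\<Sum>k\<in>Poly_Mapping.keys x. Poly_Mapping.single k (g k))"
    and y: "y = (\<Sum>k\<in>Poly_Mapping.keys y. Poly_Mapping.single k (h k))"
    by (metis poly_mapping_sum_monomials)
  let ?T = "{(J, K). J + K = I}"
  have single: "(\<Sum>(J, K)\<in>?T. (c when j = J) * (d when k = K)) = (c * d when j + k = I)"
    for j k :: "'a sentence" and c d :: 'k
  proof -
    have "(\<Sum>(J, K)\<in>?T. (c when j = J) * (d when k = K))
        = (\<Sum>p\<in>?T. if p = (j, k) then c * d else 0)"
      by (intro sum.cong) (auto simp: when_def split: if_splits)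
    also have "\<dots> = (if (j, k) \<in> ?T then c * d else 0)"
      by (rule sum.delta[OF finite_splittings])
    finally show ?thesis by (simp add: when_def)
  qed
  have "series_mult (Poly_Mapping.lookup x) (Poly_Mapping.lookup y) I
      = (\<Sum>p\<in>?T. \<Sum>j\<in>Poly_Mapping.keys x. \<Sum>k\<in>Poly_Mapping.keys y.
          (case p of (J, K) \<Rightarrow> (g j when j = J) * (h k when k = K)))"
    by (subst x, subst y)
      (auto simp: series_mult_def lookup_sum lookup_single sum_product intro!: sum.cong)
  also have "\<dots> = (\<Sum>j\<in>Poly_Mapping.keys x. \<Sum>k\<in>Poly_Mapping.keys y.
      \<Sum>p\<in>?T. (case p of (J, K) \<Rightarrow> (g j when j = J) * (h k when k = K)))"
    by (subst sum.swap, intro sum.cong refl, subst sum.swap, rule refl)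
  also have "\<dots> = Poly_Mapping.lookup (x * y) I"
  proof -
    have "x * y = (\<Sum>j\<in>Poly_Mapping.keys x. \<Sum>k\<in>Poly_Mapping.keys y.
        Poly_Mapping.single (j + k) (g j * h k))"
      using arg_cong2[OF x y, of "(*)"] by (simp only: sum_product mult_single)
    then show ?thesis by (simp add: single lookup_sum lookup_single)
  qed
  finally show "series_mult (Poly_Mapping.lookup x) (Poly_Mapping.lookup y) I
      = Poly_Mapping.lookup (x * y) I" .
qed

lemma series_H_summable:
  "series_summable (\<lambda>w. Poly_Mapping.lookup (nsym_H (one_word w)) :: _ \<Rightarrow> 'k::field) (nonempty_words A)"
  unfolding series_summable_def
proof
  fix I :: "'a sentence"
  have "{w \<in> nonempty_words A. Poly_Mapping.lookup (nsym_H (one_word w)) I \<noteq> (0::'k)}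
      \<subseteq> set (words I)"
    by (auto simp: nsym_H_def lookup_single when_def nonempty_words_def one_word.rep_eq split: if_splits)
  then show "finite {w \<in> nonempty_words A. Poly_Mapping.lookup (nsym_H (one_word w)) I \<noteq> (0::'k)}"
    by (rule finite_subset) simp
qed

lemma series_power_eq_0:
  assumes "F 0 = 0" "sent_length I < n"
  shows "series_power F n I = 0"
  using assms(2)
proof (induction n arbitrary: I)
  case (Suc n)
  have "F J * series_power F n K = 0" if "J + K = I" for J K
  proof (cases "J = 0")
    case False
    then have "0 < sent_length J" by transfer simp
    moreover have "sent_length I = sent_length J + sent_length K"
      using that by transfer auto
    ultimately have "sent_length K < n" using Suc.prems by simp
    then show ?thesis by (simp add: Suc.IH)
  qed (simp add: assms(1))
  then show ?case by (auto simp: series_mult_def intro!: sum.neutral)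
qed simp

lemma series_log1p_summable:
  assumes "F 0 = 0"
  shows "series_summable (\<lambda>n. series_scale (c n) (series_power F n)) S"
  unfolding series_summable_def
proof
  fix I
  have "{n \<in> S. series_scale (c n) (series_power F n) I \<noteq> 0} \<subseteq> {..sent_length I}"
    using series_power_eq_0[of F I, OF assms] by (auto simp: series_scale_def not_le[symmetric])
  then show "finite {n \<in> S. series_scale (c n) (series_power F n) I \<noteq> 0}"
    by (rule finite_subset) simp
qed

lemma series_H_0: "series_H A 0 = 0"
  by (auto simp: series_H_def series_sum_def nsym_H_def lookup_single when_def nonempty_words_def
      words_inject[symmetric] one_word.rep_eq zero_sentence.rep_eq)

lemma series_basis_summable:
  "series_summable (\<lambda>I. series_scale (c I) (Poly_Mapping.lookup (nsym_H I))) S"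
  unfolding series_summable_def
proof
  fix J
  have "{I \<in> S. series_scale (c I) (Poly_Mapping.lookup (nsym_H I)) J \<noteq> 0} \<subseteq> {J}"
    by (auto simp: series_scale_def nsym_H_def lookup_single when_def split: if_splits)
  then show "finite {I \<in> S. series_scale (c I) (Poly_Mapping.lookup (nsym_H I)) J \<noteq> 0}"
    by (rule finite_subset) simp
qed

lemma finite_lists_mset:
  "finite {I. mset (concat (words I)) = M}"
proof (rule finite_imageD)
  let ?L = "{ws. set ws \<subseteq> {w. set w \<subseteq> set_mset M \<and> length w \<le> size M} \<and> length ws \<le> size M}"
  have len: "length ws \<le> length (concat ws)" if "[] \<notin> set ws" for ws :: "'a list list"
    using that
  proof (induction ws)
    case (Cons w ws)
    then have "0 < length w" "length ws \<le> length (concat ws)" by auto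
    then have "length (w # ws) \<le> length w + length (concat ws)"
      unfolding list.size by linarith
    then show ?case by simp
  qed simp
  have "words I \<in> ?L" if "mset (concat (words I)) = M" for I
  proof -
    have sz: "length (concat (words I)) = size M" and st: "set (concat (words I)) = set_mset M"
      using that by (metis size_mset, metis set_mset_mset)
    have "length w \<le> size M" if "w \<in> set (words I)" for w
      using that unfolding sz[symmetric] by (simp add: length_concat member_le_sum_list)
    moreover have "length (words I) \<le> size M"
      using len[of "words I"] words[of I] by (simp add: sz)
    ultimately show ?thesis using st by auto
  qed
  then have "words ` {I. mset (concat (words I)) = M} \<subseteq> ?L" by blast
  moreover have "finite ?L"
    by (intro finite_lists_length_le finite_lists_length_le[OF finite_set_mset])
  ultimately show "finite (words ` {I. mset (concat (words I)) = M})" by (rule finite_subset)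
  show "inj_on words {I. mset (concat (words I)) = M}" by (simp add: inj_on_def words_inject)
qed

lemma keys_coprod_nsym_H:
  assumes "(J, K) \<in> Poly_Mapping.keys (coprod (nsym_H I) :: ('a, 'k::field) nsym2)"
  shows "mset (concat (words J)) + mset (concat (words K)) = mset (concat (words I))"
proof -
  have word: "mset (concat (words J)) + mset (concat (words K)) = mset w"
    if JK: "(J, K) \<in> Poly_Mapping.keys (coprod_word w :: ('a, 'k) nsym2)" for J K w
  proof -
    have "(\<Sum>(u, v)\<in>{(u, v). u @ v = w}.
        Poly_Mapping.lookup (Poly_Mapping.single (one_word u, one_word v) (1::'k)) (J, K)) \<noteq> 0"
      using JK by (simp add: in_keys_iff coprod_word_def lookup_sum tensor_nsym_H split_beta)
    then obtain u v where uv: "u @ v = w" "one_word u = J" "one_word v = K"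
      by (fastforce elim!: sum.not_neutral_contains_not_neutral
          simp: lookup_single when_def split: if_splits)
    have "concat (words (one_word u)) = u" for u :: "'a list" by (simp add: one_word.rep_eq)
    with uv show ?thesis by (metis mset_append)
  qed
  have "mset (concat (words J)) + mset (concat (words K)) = mset (concat ws)"
    if "(J, K) \<in> Poly_Mapping.keys (prod_list (map coprod_word ws) :: ('a, 'k) nsym2)" for ws J K
    using that
  proof (induction ws arbitrary: J K)
    case Nil
    then show ?case by (simp add: zero_prod_def zero_sentence.rep_eq)
  next
    case (Cons w ws)
    have "(J, K) \<in> Poly_Mapping.keys (coprod_word w * prod_list (map coprod_word ws) :: ('a, 'k) nsym2)"
      using Cons.prems by simp
    then obtain J1 K1 J2 K2 where
      1: "(J1, K1) \<in> Poly_Mapping.keys (coprod_word w :: ('a, 'k) nsym2)" and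
      2: "(J2, K2) \<in> Poly_Mapping.keys (prod_list (map coprod_word ws) :: ('a, 'k) nsym2)" and
      eq: "J = J1 + J2" "K = K1 + K2"
      using keys_mult[of "coprod_word w :: ('a, 'k) nsym2" "prod_list (map coprod_word ws)"]
      by fastforce
    show ?case
      using word[OF 1] Cons.IH[OF 2] by (simp add: eq plus_sentence.rep_eq ac_simps)
  qed
  then show ?thesis using assms by (simp add: coprod_nsym_H)
qed

lemma series_coprod_summable:
  "series_summable (\<lambda>I. series_scale (G I :: 'k::field) (Poly_Mapping.lookup (coprod (nsym_H I)))) S"
  unfolding series_summable_def
proof
  fix p :: "'a sentence \<times> 'a sentence"
  have "{I \<in> S. series_scale (G I) (Poly_Mapping.lookup (coprod (nsym_H I))) p \<noteq> 0}
      \<subseteq> {I. mset (concat (words I)) = mset (concat (words (fst p))) + mset (concat (words (snd p)))}"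
    using keys_coprod_nsym_H[of "fst p" "snd p", where 'k = 'k]
    by (auto simp: series_scale_def in_keys_iff)
  then show "finite {I \<in> S. series_scale (G I) (Poly_Mapping.lookup (coprod (nsym_H I))) p \<noteq> 0}"
    using finite_lists_mset by (rule finite_subset)
qed

end

theory Submission
  imports Defs
begin

text \<open>
  A term of \<open>\<Delta>(H\<^sub>I)\<close> cuts every word of \<open>I\<close> into a prefix and a suffix, so the coefficient of
  \<open>H\<^sub>J \<otimes> H\<^sub>K\<close> in \<open>\<Delta>(P)\<close> is a sum over the sequences of pairs \<open>(u, v)\<close>, not both empty, whose non-empty
  first components spell \<open>J\<close> and whose non-empty second components spell \<open>K\<close>. The coefficients of \<open>P\<close>
  depend only on the length of the sentence, so this is the coefficient of \<open>x\<^sup>j y\<^sup>k\<close>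
  in \<open>log (1 + (x + y + xy))\<close>, where \<open>j\<close> and \<open>k\<close> are the lengths of \<open>J\<close> and \<open>K\<close>. It vanishes for \<open>j, k > 0\<close>,
  because the derivative with respect to \<open>x\<close> is \<open>1 / (1 + x)\<close>.
\<close>

section \<open>The logarithm in the basis of complete homogeneous functions\<close>

lemma words_one_word: "w \<noteq> [] \<Longrightarrow> words (one_word w) = [w]"
  by (simp add: one_word.rep_eq)

lemma series_H_eq:
  "(series_H A I :: 'k::field) = (if \<exists>w\<in>nonempty_words A. I = one_word w then 1 else 0)"
proof -
  let ?S = "{w \<in> nonempty_words A. Poly_Mapping.lookup (nsym_H (one_word w)) I \<noteq> (0::'k)}"
  have S: "?S = {w \<in> nonempty_words A. I = one_word w}"
    by (auto simp: nsym_H_def lookup_single when_def)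
  show ?thesis
  proof (cases "\<exists>w\<in>nonempty_words A. I = one_word w")
    case True
    then obtain w where w: "w \<in> nonempty_words A" "I = one_word w" by blast
    have "w' = w" if "w' \<in> nonempty_words A" "I = one_word w'" for w'
    proof -
      have "w \<noteq> []" "w' \<noteq> []" using that w by (auto simp: nonempty_words_def)
      moreover have "words (one_word w') = words (one_word w)" using that w by simp
      ultimately show ?thesis by (simp add: words_one_word)
    qed
    then have "?S = {w}" using w unfolding S by blast
    then show ?thesis using w by (auto simp: series_H_def series_sum_def nsym_H_def)
  next
    case False
    then have "?S = {}" unfolding S by blast
    then show ?thesis using False by (simp add: series_H_def series_sum_def)
  qed
qed

lemma words_0: "words 0 = []"
  by (simp add: zero_sentence.rep_eq)

lemma words_eq_Nil_iff: "words I = [] \<longleftrightarrow> I = 0"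
  by (metis words_0 words_inject)

text \<open>In a factorization \<open>J + K = I\<close> with \<open>J\<close> a one-word sentence,
  \<open>J\<close> must be the first word of \<open>I\<close> and \<open>K\<close> the rest. So the
  Cauchy product has at most one nonzero term, and no multiplicities arise.\<close>

lemma series_power_H:
  "(series_power (series_H A) n I :: 'k::field)
    = (if I \<in> sentences A \<and> sent_length I = n then 1 else 0)"
proof (induction n arbitrary: I)
  case 0
  have "sent_length I = 0 \<longleftrightarrow> I = 0"
    by (simp add: sent_length.rep_eq words_eq_Nil_iff)
  moreover have "(0 :: 'a sentence) \<in> sentences A"
    by (simp add: sentences_def words_0)
  ultimately show ?case
    by (auto simp: series_one_def lookup_one when_def)
next
  case (Suc n)
  let ?f = "\<lambda>(J, K). series_H A J * series_power (series_H A) n K :: 'k"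
  let ?T = "{(J, K). J + K = I}"
  have nz: "\<exists>w. w \<in> nonempty_words A \<and> J = one_word w \<and> K \<in> sentences A \<and> sent_length K = n"
    if "?f (J, K) \<noteq> 0" for J K
    using that by (auto simp: Suc.IH series_H_eq split: if_splits)
  show ?case
  proof (cases "I \<in> sentences A \<and> sent_length I = Suc n")
    case True
    then obtain w ws where ws: "words I = w # ws"
      by (cases "words I") (auto simp: sent_length.rep_eq)
    have ne: "[] \<notin> set (words I)" using words[of I] by simp
    define K where "K = Sentence ws"
    have K: "words K = ws" using ne unfolding K_def ws by (intro Sentence_inverse) simp
    have w: "w \<in> nonempty_words A" using True by (simp add: sentences_def ws)
    then have w': "words (one_word w) = [w]"
      by (simp add: words_one_word nonempty_words_def)
    have "words (one_word w + K) = words I" by (simp add: plus_sentence.rep_eq K w' ws)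
    then have mem: "(one_word w, K) \<in> ?T" by (simp add: words_inject)
    have "(J, L) = (one_word w, K)" if JL: "J + L = I" "?f (J, L) \<noteq> 0" for J L
    proof -
      obtain v where v: "v \<in> nonempty_words A" "J = one_word v" using nz[OF JL(2)] by blast
      then have "words J = [v]" by (simp add: words_one_word nonempty_words_def)
      then have "v # words L = w # ws" using JL(1) ws by (auto simp: plus_sentence.rep_eq)
      then have "v = w" "words L = words K" using K by simp_all
      then show ?thesis using v(2) by (simp add: words_inject)
    qed
    then have "\<forall>p\<in>?T - {(one_word w, K)}. ?f p = 0" by blast
    then have "sum ?f ?T = sum ?f {(one_word w, K)}"
      using mem by (intro sum.mono_neutral_right[OF finite_splittings]) blast+
    also have "\<dots> = 1"
    proof -
      have "K \<in> sentences A" "sent_length K = n"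
        using True by (simp_all add: sentences_def sent_length.rep_eq K ws)
      moreover have "series_H A (one_word w) = (1::'k)"
        using w unfolding series_H_eq by auto
      ultimately show ?thesis by (simp add: Suc.IH)
    qed
    finally show ?thesis using True by (simp add: series_mult_def)
  next
    case False
    have "?f (J, K) = 0" if "J + K = I" for J K
    proof (rule ccontr)
      assume "?f (J, K) \<noteq> 0"
      then obtain w where w: "w \<in> nonempty_words A" "J = one_word w" "K \<in> sentences A"
        "sent_length K = n" using nz by blast
      then have "words J = [w]" by (simp add: words_one_word nonempty_words_def)
      then have "words I = w # words K" using that by (auto simp: plus_sentence.rep_eq)
      then show False using False w by (auto simp: sentences_def sent_length.rep_eq)
    qed
    then have "sum ?f ?T = 0" by (intro sum.neutral) auto
    then show ?thesis using False by (simp add: series_mult_def)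
  qed
qed

text \<open>Since \<open>x / 0 = 0\<close>, the formula also gives the correct coefficient \<open>0\<close> at the empty sentence.\<close>

lemma series_P_eq:
  "(series_P A I :: 'k::field)
    = (if I \<in> sentences A then (-1) ^ (sent_length I - 1) / of_nat (sent_length I) else 0)"
proof -
  define f :: "nat \<Rightarrow> 'k" where
    "f n = series_scale ((-1) ^ (n - 1) / of_nat n) (series_power (series_H A) n) I" for n
  have f: "f n = (if n = sent_length I \<and> I \<in> sentences A
      then (-1) ^ (n - 1) / of_nat n else 0)" for n
    by (auto simp: f_def series_scale_def series_power_H)
  have sub: "{n \<in> {1..}. f n \<noteq> 0} \<subseteq> {sent_length I}"
    by (auto simp: f split: if_splits)
  have "series_P A I = sum f {n \<in> {1..}. f n \<noteq> 0}"
    by (simp add: series_P_def series_log1p_def series_sum_def f_def)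
  \<comment> \<open>For the empty sentence the index 0 lies outside \<open>{1..}\<close>; the term
    \<open>f 0\<close> added here is a division by zero, hence 0.\<close>
  also have "\<dots> = sum f {sent_length I}"
    by (intro sum.mono_neutral_left sub) (auto simp: f Suc_le_eq intro!: gr0I)
  finally show ?thesis by (simp add: f)
qed

lemma series_sum_basis:
  "series_sum (\<lambda>I. series_scale (c I) (Poly_Mapping.lookup (nsym_H I))) S J
    = (if J \<in> S then c J else (0 :: 'k::field))"
proof -
  let ?f = "\<lambda>I. series_scale (c I) (Poly_Mapping.lookup (nsym_H I)) J"
  have f: "?f I = (if I = J then c J else 0)" for I
    by (simp add: series_scale_def nsym_H_def lookup_single when_def)
  have "sum ?f {I \<in> S. ?f I \<noteq> 0} = sum ?f ({J} \<inter> S)"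
    by (rule sum.mono_neutral_left) (auto simp: f)
  then show ?thesis by (simp add: series_sum_def f Int_insert_left)
qed

section \<open>The coproduct as a sum over overlaps\<close>

abbreviation join :: "('a list \<times> 'a list) list \<Rightarrow> 'a list list" where
  "join ps \<equiv> map (\<lambda>(u, v). u @ v) ps"

text \<open>A pair \<open>(u, v)\<close> is a cut of the word \<open>u @ v\<close>. The sum in the
  product monoid concatenates prefixes and suffixes separately, and \<open>one_word\<close> drops
  the empty ones.\<close>

abbreviation split_pair :: "('a list \<times> 'a list) list \<Rightarrow> 'a sentence \<times> 'a sentence" where
  "split_pair ps \<equiv> sum_list (map (\<lambda>(u, v). (one_word u, one_word v)) ps)"

lemma finite_join: "finite {ps. join ps = ws}"
proof (induction ws)
  case (Cons w ws)
  have "{ps. join ps = w # ws} = (\<lambda>(p, ps). p # ps) ` ({(u, v). u @ v = w} \<times> {ps. join ps = ws})"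
    by (auto simp: map_eq_Cons_conv)
  then show ?case by (simp add: finite_factorizations Cons.IH)
qed simp

text \<open>Expanding the product by distributivity amounts to choosing one cut for each
  word.\<close>

lemma prod_coprod_word:
  "prod_list (map coprod_word ws)
    = (\<Sum>ps\<in>{ps. join ps = ws}. Poly_Mapping.single (split_pair ps) (1 :: 'k::field))"
proof (induction ws)
  case Nil
  then show ?case by (simp flip: zero_prod_def)
next
  case (Cons w ws)
  let ?W = "{(u, v). u @ v = w}"
  let ?L = "{ps. join ps = ws}"
  have eq: "{ps. join ps = w # ws} = (\<lambda>(p, ps). p # ps) ` (?W \<times> ?L)"
    by (auto simp: map_eq_Cons_conv)
  have "prod_list (map coprod_word (w # ws))
      = (\<Sum>p\<in>?W. \<Sum>ps\<in>?L. Poly_Mapping.single (split_pair (p # ps)) (1 :: 'k))"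
    by (simp add: Cons.IH coprod_word_def tensor_nsym_H sum_product mult_single case_prod_beta')
  also have "\<dots> = (\<Sum>ps\<in>{ps. join ps = w # ws}. Poly_Mapping.single (split_pair ps) 1)"
    unfolding eq sum.cartesian_product
    by (subst sum.reindex) (auto simp: inj_on_def intro!: sum.cong)
  finally show ?case .
qed

text \<open>Different cuts may give the same tensor, as for a sentence with two equal one-letter
  words, so the coefficient is a cardinality and not just 0 or 1.\<close>

lemma coprod_nsym_H_lookup:
  "Poly_Mapping.lookup (coprod (nsym_H I)) p
    = (of_nat (card {ps. join ps = words I \<and> split_pair ps = p}) :: 'k::field)"
proof -
  have "Poly_Mapping.lookup (coprod (nsym_H I)) p
      = (\<Sum>ps\<in>{ps. join ps = words I}. if split_pair ps = p then 1 else (0::'k))"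
    by (simp add: coprod_nsym_H prod_coprod_word lookup_sum lookup_single when_def)
  also have "\<dots> = (\<Sum>ps\<in>{ps \<in> {ps. join ps = words I}. split_pair ps = p}. 1)"
    by (rule sum.inter_filter[symmetric, OF finite_join])
  finally show ?thesis by simp
qed

section \<open>Overlaps of two sentences and their recursion\<close>

text \<open>These are the quasi-shuffles of \<open>js\<close> and \<open>ks\<close>: each pair uses
  up the next word of one list or of both. Forbidding \<open>([], [])\<close> matches the absence of
  empty words in sentences and keeps the set finite.\<close>

definition overlaps :: "'a list list \<Rightarrow> 'a list list \<Rightarrow> ('a list \<times> 'a list) list set" where
  "overlaps js ks = {ps. ([], []) \<notin> set ps
    \<and> filter (\<lambda>u. u \<noteq> []) (map fst ps) = js \<and> filter (\<lambda>v. v \<noteq> []) (map snd ps) = ks}"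

lemma split_pair_eq_iff:
  "split_pair ps = (J, K) \<longleftrightarrow> filter (\<lambda>u. u \<noteq> []) (map fst ps) = words J
    \<and> filter (\<lambda>v. v \<noteq> []) (map snd ps) = words K"
proof -
  have "words (fst (split_pair ps)) = filter (\<lambda>u. u \<noteq> []) (map fst ps)
      \<and> words (snd (split_pair ps)) = filter (\<lambda>v. v \<noteq> []) (map snd ps)"
    by (induction ps) (auto simp: words_0 plus_sentence.rep_eq one_word.rep_eq)
  then show ?thesis by (metis prod.collapse fst_conv snd_conv words_inject)
qed

lemma overlaps_Nil1: "[] \<notin> set ks \<Longrightarrow> overlaps [] ks = {map (Pair []) ks}"
proof (intro equalityI subsetI)
  fix ps assume "ps \<in> overlaps [] ks"
  then have ps: "([], []) \<notin> set ps" "\<forall>p\<in>set ps. fst p = []"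
    "filter (\<lambda>v. v \<noteq> []) (map snd ps) = ks"
    by (auto simp: overlaps_def filter_empty_conv)
  then have "\<forall>p\<in>set ps. snd p \<noteq> []" by (metis prod.collapse)
  then have "map snd ps = ks" using ps(3) by (simp add: filter_True)
  then have "map (Pair []) ks = map (\<lambda>p. ([], snd p)) ps" by auto
  also have "\<dots> = ps" using ps(2) by (intro map_idI) (metis prod.collapse)
  finally show "ps \<in> {map (Pair []) ks}" by simp
qed (auto simp: overlaps_def filter_empty_conv comp_def intro: filter_True)

text \<open>Swapping is an involution, so one inclusion applied in both directions suffices. This
  carries the case of an empty first list over to the second.\<close>

lemma overlaps_swap: "overlaps ks js = map prod.swap ` overlaps js ks"
proof -
  have sub: "map prod.swap ` overlaps js ks \<subseteq> overlaps ks js" for js ks :: "'a list list"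
    by (auto simp: overlaps_def comp_def)
  have "map prod.swap ` map prod.swap ` overlaps ks js \<subseteq> map prod.swap ` overlaps js ks"
    by (intro image_mono sub)
  then show ?thesis using sub[of js ks] by (auto simp: image_image)
qed

lemma overlaps_Nil2: "[] \<notin> set js \<Longrightarrow> overlaps js [] = {map (\<lambda>u. (u, [])) js}"
  by (subst overlaps_swap) (simp add: overlaps_Nil1)

text \<open>The first pair takes \<open>j\<close> alone, \<open>k\<close> alone, or both; this is
  the recursion of the Delannoy numbers.\<close>

lemma overlaps_Cons:
  assumes "j \<noteq> []" "k \<noteq> []"
  shows "overlaps (j # js) (k # ks) = Cons (j, []) ` overlaps js (k # ks)
    \<union> Cons ([], k) ` overlaps (j # js) ks \<union> Cons (j, k) ` overlaps js ks"
proof (intro equalityI subsetI)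
  fix ps assume ps: "ps \<in> overlaps (j # js) (k # ks)"
  then obtain u v qs where qs: "ps = (u, v) # qs"
    by (cases ps) (auto simp: overlaps_def)
  consider "u = []" "v \<noteq> []" | "u \<noteq> []" "v = []" | "u \<noteq> []" "v \<noteq> []"
    using ps by (auto simp: overlaps_def qs)
  then show "ps \<in> Cons (j, []) ` overlaps js (k # ks)
    \<union> Cons ([], k) ` overlaps (j # js) ks \<union> Cons (j, k) ` overlaps js ks"
  proof cases
    case 1
    then have "v = k" "qs \<in> overlaps (j # js) ks" using ps by (simp_all add: overlaps_def qs)
    with 1 show ?thesis by (simp add: qs)
  next
    case 2
    then have "u = j" "qs \<in> overlaps js (k # ks)" using ps by (simp_all add: overlaps_def qs)
    with 2 show ?thesis by (simp add: qs)
  next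
    case 3
    then have "u = j" "v = k" "qs \<in> overlaps js ks" using ps by (simp_all add: overlaps_def qs)
    with 3 show ?thesis by (simp add: qs)
  qed
next
  fix ps assume "ps \<in> Cons (j, []) ` overlaps js (k # ks)
    \<union> Cons ([], k) ` overlaps (j # js) ks \<union> Cons (j, k) ` overlaps js ks"
  then consider qs where "qs \<in> overlaps js (k # ks)" "ps = (j, []) # qs"
    | qs where "qs \<in> overlaps (j # js) ks" "ps = ([], k) # qs"
    | qs where "qs \<in> overlaps js ks" "ps = (j, k) # qs" by blast
  then show "ps \<in> overlaps (j # js) (k # ks)"
    by cases (use assms in \<open>simp_all add: overlaps_def\<close>)
qed

lemma finite_overlaps:
  "[] \<notin> set js \<Longrightarrow> [] \<notin> set ks \<Longrightarrow> finite (overlaps js ks)"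
proof (induction "length js + length ks" arbitrary: js ks rule: less_induct)
  case less
  show ?case
  proof (cases "js = [] \<or> ks = []")
    case True
    then show ?thesis using less.prems by (auto simp: overlaps_Nil1 overlaps_Nil2)
  next
    case False
    then obtain j js' k ks' where "js = j # js'" "ks = k # ks'" by (meson neq_Nil_conv)
    then show ?thesis using less by (auto simp: overlaps_Cons)
  qed
qed

text \<open>A Delannoy recursion weighted by \<open>f\<close> at the number of steps; the constant
  \<open>f = 1\<close> gives the Delannoy numbers. Each step shifts the argument of \<open>f\<close>
  by one.\<close>

fun overlap_sum :: "(nat \<Rightarrow> 'k::comm_monoid_add) \<Rightarrow> nat \<Rightarrow> nat \<Rightarrow> 'k" where
  "overlap_sum f 0 k = f k"
| "overlap_sum f (Suc j) 0 = f (Suc j)"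
| "overlap_sum f (Suc j) (Suc k) = overlap_sum (\<lambda>n. f (Suc n)) j (Suc k)
    + overlap_sum (\<lambda>n. f (Suc n)) (Suc j) k + overlap_sum (\<lambda>n. f (Suc n)) j k"

lemma overlap_sum_0: "overlap_sum f j 0 = f j"
  by (cases j) simp_all

lemma sum_overlaps:
  assumes "[] \<notin> set js" "[] \<notin> set ks"
  shows "(\<Sum>ps\<in>overlaps js ks. f (length ps)) = overlap_sum f (length js) (length ks)"
  using assms
proof (induction "length js + length ks" arbitrary: f js ks rule: less_induct)
  case less
  show ?case
  proof (cases "js = [] \<or> ks = []")
    case True
    then show ?thesis using less.prems by (auto simp: overlaps_Nil1 overlaps_Nil2 overlap_sum_0)
  next
    case False
    then obtain j js' k ks' where [simp]: "js = j # js'" "ks = k # ks'" by (meson neq_Nil_conv)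
    have ne: "j \<noteq> []" "k \<noteq> []" using less.prems by auto
    have fin: "finite (overlaps js' ks)" "finite (overlaps js ks')" "finite (overlaps js' ks')"
      using less.prems by (auto intro!: finite_overlaps)
    have cons: "(\<Sum>ps\<in>Cons p ` S. f (length ps)) = (\<Sum>ps\<in>S. f (Suc (length ps)))"
      for p :: "'a list \<times> 'a list" and S
      by (subst sum.reindex) auto
    have "(\<Sum>ps\<in>overlaps js ks. f (length ps)) = (\<Sum>ps\<in>overlaps js' ks. f (Suc (length ps)))
        + (\<Sum>ps\<in>overlaps js ks'. f (Suc (length ps))) + (\<Sum>ps\<in>overlaps js' ks'. f (Suc (length ps)))"
      \<comment> \<open>The three images are disjoint because their first pairs differ,
        \<open>j\<close> and \<open>k\<close> being non-empty.\<close>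
      using ne fin by (simp add: overlaps_Cons cons) (subst sum.union_disjoint; auto simp: cons)+
    also have "\<dots> = overlap_sum f (length js) (length ks)"
      using less.prems by (simp add: less.hyps[where f = "\<lambda>n. f (Suc n)"])
    finally show ?thesis .
  qed
qed

section \<open>Coefficients of the coproduct of a series\<close>

text \<open>Each \<open>I\<close> contributes \<open>G I\<close> once for every overlap that joins
  to \<open>I\<close>. Grouping overlaps by their joined sentence turns the sum over all
  \<open>I\<close> into a finite one.\<close>

lemma series_coprod_eq:
  "series_coprod G (J, K)
    = (\<Sum>ps\<in>overlaps (words J) (words K). G (Sentence (join ps)) :: 'k::field)"
proof -
  let ?L = "overlaps (words J) (words K)"
  let ?g = "\<lambda>ps. Sentence (join ps)"
  let ?f = "\<lambda>I. series_scale (G I) (Poly_Mapping.lookup (coprod (nsym_H I))) (J, K)"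
  have L: "finite ?L" using words[of J] words[of K] by (intro finite_overlaps) auto
  have wg: "words (?g ps) = join ps" if "ps \<in> ?L" for ps
    using that by (intro Sentence_inverse) (auto simp: overlaps_def)
  have fib: "{ps. join ps = words I \<and> split_pair ps = (J, K)} = {ps \<in> ?L. ?g ps = I}" for I
  proof (intro equalityI subsetI)
    fix ps assume "ps \<in> {ps. join ps = words I \<and> split_pair ps = (J, K)}"
    then have ps: "join ps = words I" "split_pair ps = (J, K)" by auto
    \<comment> \<open>Such a pair would join to the empty word, which no sentence contains.\<close>
    have "([], []) \<notin> set ps"
    proof
      assume "([], []) \<in> set ps"
      then have "[] \<in> set (join ps)" by force
      then show False using words[of I] ps(1) by simp
    qed
    then show "ps \<in> {ps \<in> ?L. ?g ps = I}"
      using ps by (simp add: overlaps_def split_pair_eq_iff words_inverse)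
  next
    fix ps assume "ps \<in> {ps \<in> ?L. ?g ps = I}"
    then show "ps \<in> {ps. join ps = words I \<and> split_pair ps = (J, K)}"
      using wg by (auto simp: split_pair_eq_iff overlaps_def)
  qed
  have f: "?f I = (\<Sum>ps\<in>{ps \<in> ?L. ?g ps = I}. G (?g ps))" for I
    by (simp add: series_scale_def coprod_nsym_H_lookup fib)
  have sub: "{I \<in> UNIV. ?f I \<noteq> 0} \<subseteq> ?g ` ?L"
  proof
    fix I assume "I \<in> {I \<in> UNIV. ?f I \<noteq> 0}"
    then have "{ps \<in> ?L. ?g ps = I} \<noteq> {}" unfolding f by (metis (mono_tags, lifting) mem_Collect_eq sum.empty)
    then show "I \<in> ?g ` ?L" by blast
  qed
  have "series_coprod G (J, K) = sum ?f {I \<in> UNIV. ?f I \<noteq> 0}"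
    by (simp add: series_coprod_def series_sum_def)
  also have "\<dots> = sum ?f (?g ` ?L)"
    by (rule sum.mono_neutral_left) (use L sub in auto)
  also have "\<dots> = (\<Sum>ps\<in>?L. G (?g ps))"
    unfolding f using L by (intro sum.group) auto
  finally show ?thesis .
qed

text \<open>The letters of the joined sentence are those of \<open>J\<close> and \<open>K\<close>
  together, and each pair yields exactly one word.\<close>

lemma join_in_sentences:
  assumes "ps \<in> overlaps (words J) (words K)"
  shows "Sentence (join ps) \<in> sentences A \<longleftrightarrow> J \<in> sentences A \<and> K \<in> sentences A"
    and "sent_length (Sentence (join ps)) = length ps"
proof -
  have w: "words (Sentence (join ps)) = join ps"
    using assms by (intro Sentence_inverse) (auto simp: overlaps_def)
  then show "sent_length (Sentence (join ps)) = length ps"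
    by (simp add: sent_length.rep_eq)
  have J: "words J = filter (\<lambda>u. u \<noteq> []) (map fst ps)"
    and K: "words K = filter (\<lambda>v. v \<noteq> []) (map snd ps)" and ne: "([], []) \<notin> set ps"
    using assms by (simp_all add: overlaps_def)
  have mem: "I \<in> sentences A \<longleftrightarrow> (\<forall>v\<in>set (words I). v \<noteq> [] \<and> set v \<subseteq> A)" for I
    by (auto simp: sentences_def nonempty_words_def)
  have "fst p \<noteq> [] \<or> snd p \<noteq> []" if "p \<in> set ps" for p
    using ne that by (metis prod.collapse)
  then have "Sentence (join ps) \<in> sentences A \<longleftrightarrow> (\<forall>p\<in>set ps. set (fst p) \<union> set (snd p) \<subseteq> A)"
    unfolding mem w set_map ball_simps(9) split_beta set_append append_is_Nil_conv by blast
  moreover have "J \<in> sentences A \<longleftrightarrow> (\<forall>p\<in>set ps. set (fst p) \<subseteq> A)"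
    unfolding mem J set_filter set_map by fastforce
  moreover have "K \<in> sentences A \<longleftrightarrow> (\<forall>p\<in>set ps. set (snd p) \<subseteq> A)"
    unfolding mem K set_filter set_map by fastforce
  ultimately show "Sentence (join ps) \<in> sentences A \<longleftrightarrow> J \<in> sentences A \<and> K \<in> sentences A"
    by blast
qed

section \<open>The logarithm of a product, coefficientwise\<close>

lemma overlap_sum_add:
  "overlap_sum (\<lambda>n. f n + g n :: 'k::comm_monoid_add) j k = overlap_sum f j k + overlap_sum g j k"
proof (induction f j k arbitrary: g rule: overlap_sum.induct)
  case (3 f j k)
  show ?case by (simp only: overlap_sum.simps 3) (simp only: ac_simps)
qed simp_all

text \<open>This is the factorization of \<open>1 / ((1 + x) * (1 + y))\<close> into two geometric
  series. The factor \<open>a\<close> closes the statement under the shift, which replaces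
  \<open>a\<close> by \<open>- a\<close>.\<close>

lemma overlap_sum_minus_one:
  "overlap_sum (\<lambda>n. a * (-1) ^ n :: 'k::comm_ring_1) j k = a * (-1) ^ (j + k)"
proof (induction "\<lambda>n. a * (-1) ^ n" j k arbitrary: a rule: overlap_sum.induct)
  case (3 j k a)
  have "(\<lambda>n. a * (-1) ^ Suc n) = (\<lambda>n. (- a) * (-1) ^ n)" by simp
  then show ?case using 3[of "- a"] by simp
qed simp_all

text \<open>
  \<open>overlap_sum f j k\<close> is the coefficient of \<open>x\<^sup>j y\<^sup>k\<close> in \<open>\<Sum>n. f n * ((1 + x) * (1 + y) - 1)\<^sup>n\<close>;
  this is its derivative with respect to \<open>x\<close>.
\<close>

lemma overlap_sum_deriv:
  fixes f :: "nat \<Rightarrow> 'k::comm_ring_1"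
  shows "of_nat (Suc j) * overlap_sum f (Suc j) (Suc k)
    = overlap_sum (\<lambda>n. of_nat (Suc n) * f (Suc n)) j (Suc k)
      + overlap_sum (\<lambda>n. of_nat (Suc n) * f (Suc n)) j k"
proof (induction "j + k" arbitrary: f j k rule: less_induct)
  case less
  \<comment> \<open>Writing \<open>f(z) = f(0) + z s(z)\<close> reduces the claim to
    \<open>s\<close> at smaller indices. \<open>D\<close> lists the coefficients of
    \<open>s'\<close>, and \<open>split\<close> reflects the product rule
    \<open>f' = s + z s'\<close>.\<close>
  define s where "s = (\<lambda>n. f (Suc n))"
  define D where "D n = of_nat (Suc n) * s (Suc n)" for n
  have split: "overlap_sum (\<lambda>n. of_nat (Suc (Suc n)) * s (Suc n)) j k
      = overlap_sum D j k + overlap_sum (\<lambda>n. s (Suc n)) j k" for j k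
    unfolding overlap_sum_add[symmetric] by (simp add: D_def algebra_simps)
  let ?g = "\<lambda>n. of_nat (Suc n) * s n"
  note IH = less[where f = s, folded D_def]
  have step: "of_nat (Suc j) * overlap_sum f (Suc j) (Suc k)
      = of_nat (Suc j) * overlap_sum s j (Suc k) + of_nat (Suc j) * overlap_sum s (Suc j) k
        + of_nat (Suc j) * overlap_sum s j k"
    by (simp only: overlap_sum.simps s_def distrib_left)
  have "of_nat (Suc j) * overlap_sum f (Suc j) (Suc k) = overlap_sum ?g j (Suc k) + overlap_sum ?g j k"
  proof (cases j)
    case 0
    show ?thesis
    proof (cases k)
      case 0
      with \<open>j = 0\<close> show ?thesis unfolding step by (simp add: algebra_simps)
    next
      case (Suc k')
      with \<open>j = 0\<close> have "overlap_sum s (Suc 0) (Suc k') = D (Suc k') + D k'"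
        using IH[of 0 k'] by simp
      with \<open>j = 0\<close> Suc show ?thesis unfolding step
        by (simp del: overlap_sum.simps(3)) (simp add: D_def algebra_simps)
    qed
  next
    case (Suc j')
    \<comment> \<open>One copy is split off so that the remaining factor \<open>Suc j'\<close> fits
      the induction hypothesis; the copy accounts for the undifferentiated terms of
      \<open>split\<close>.\<close>
    have first: "of_nat (Suc j) * overlap_sum s j l
        = overlap_sum s j l + of_nat (Suc j') * overlap_sum s (Suc j') l" for l
      by (simp add: Suc algebra_simps)
    show ?thesis
    proof (cases k)
      case 0
      have ih: "of_nat (Suc j') * overlap_sum s (Suc j') (Suc 0) = overlap_sum D j' (Suc 0) + D j'"
        using IH[of j' 0] Suc 0 by (simp only: overlap_sum_0)
      have "overlap_sum s (Suc j') (Suc 0)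
          = overlap_sum (\<lambda>n. s (Suc n)) j' (Suc 0) + s (Suc (Suc j')) + s (Suc j')"
        by (simp add: overlap_sum_0)
      moreover have "overlap_sum ?g (Suc j') (Suc 0)
          = overlap_sum D j' (Suc 0) + overlap_sum (\<lambda>n. s (Suc n)) j' (Suc 0)
            + of_nat (Suc (Suc (Suc j'))) * s (Suc (Suc j')) + of_nat (Suc (Suc j')) * s (Suc j')"
        by (simp only: overlap_sum.simps overlap_sum_0 split) (simp add: D_def algebra_simps)
      ultimately show ?thesis
        unfolding step first unfolding Suc 0 ih
        by (simp only: overlap_sum_0 D_def) (simp only: of_nat_Suc algebra_simps mult_1_left)
    next
      case k: (Suc k')
      have ih: "of_nat (Suc j') * overlap_sum s (Suc j') (Suc k)
            = overlap_sum D j' (Suc k) + overlap_sum D j' k"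
          "of_nat (Suc j') * overlap_sum s (Suc j') k = overlap_sum D j' k + overlap_sum D j' k'"
          "of_nat (Suc (Suc j')) * overlap_sum s (Suc (Suc j')) k
            = overlap_sum D (Suc j') k + overlap_sum D (Suc j') k'"
        using IH[of j' k] IH[of j' k'] IH[of "Suc j'" k'] Suc k by simp_all
      show ?thesis
        unfolding step first unfolding Suc ih unfolding k
        by (simp only: overlap_sum.simps split) (simp only: ac_simps)
    qed
  qed
  then show ?case by (simp only: s_def)
qed

text \<open>The derivative has coefficients \<open>(-1) ^ n\<close>, so the two terms of
  \<open>overlap_sum_deriv\<close> are opposite signs and cancel. Characteristic zero then allows
  division by \<open>Suc j\<close>.\<close>

lemma overlap_sum_log:
  "overlap_sum (\<lambda>n. (-1) ^ (n - 1) / of_nat n :: 'k::field_char_0) (Suc j) (Suc k) = 0"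
proof -
  have "(\<lambda>n. of_nat (Suc n) * ((-1) ^ (Suc n - 1) / of_nat (Suc n))) = (\<lambda>n. 1 * (-1) ^ n :: 'k)"
    by (simp del: of_nat_Suc)
  then have "of_nat (Suc j) * overlap_sum (\<lambda>n. (-1) ^ (n - 1) / of_nat n :: 'k) (Suc j) (Suc k) = 0"
    unfolding overlap_sum_deriv by (simp only: overlap_sum_minus_one) simp
  then show ?thesis by (simp del: of_nat_Suc overlap_sum.simps)
qed

section \<open>Expansion and primitivity of the logarithm\<close>

theorem proposition6p7:
  fixes A :: "'a set" and P :: "('a sentence, 'k::field_char_0) series"
  assumes "finite A"
  defines "P \<equiv> series_P A"
  shows "P = series_sum
           (\<lambda>I. series_scale ((-1) ^ (sent_length I - 1) / of_nat (sent_length I))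
                  (Poly_Mapping.lookup (nsym_H I)))
           (sentences A - {0})
       \<and> series_coprod P = series_add (series_tensor series_one P) (series_tensor P series_one)"
proof
  have zero: "sent_length (0 :: 'a sentence) = 0" by (simp add: sent_length.rep_eq words_0)
  show "P = series_sum
           (\<lambda>I. series_scale ((-1) ^ (sent_length I - 1) / of_nat (sent_length I))
                  (Poly_Mapping.lookup (nsym_H I)))
           (sentences A - {0})"
    by (rule ext) (auto simp: P_def series_P_eq series_sum_basis zero)
  show "series_coprod P = series_add (series_tensor series_one P) (series_tensor P series_one)"
  proof (rule ext, clarify)
    fix J K :: "'a sentence"
    define c :: "nat \<Rightarrow> 'k" where "c n = (-1) ^ (n - 1) / of_nat n" for n
    have P: "P I = (if I \<in> sentences A then c (sent_length I) else 0)" for I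
      by (simp add: P_def series_P_eq c_def)
    have c0: "c 0 = 0" by (simp add: c_def)
    have A0: "0 \<in> sentences A" by (simp add: sentences_def words_0)
    have "series_coprod P (J, K) = (\<Sum>ps\<in>overlaps (words J) (words K).
        if J \<in> sentences A \<and> K \<in> sentences A then c (length ps) else 0)"
      unfolding series_coprod_eq P by (intro sum.cong refl) (simp add: join_in_sentences)
    also have "\<dots> = (if J \<in> sentences A \<and> K \<in> sentences A
        then overlap_sum c (sent_length J) (sent_length K) else 0)"
      using words[of J] words[of K]
      by (cases "J \<in> sentences A \<and> K \<in> sentences A")
        (auto simp: sum_overlaps sent_length.rep_eq intro!: sum.neutral)
    finally have *: "series_coprod P (J, K) = \<dots>" .
    have "J = 0 \<or> (\<exists>j. sent_length J = Suc j)" "K = 0 \<or> (\<exists>k. sent_length K = Suc k)"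
      by (metis length_0_conv not0_implies_Suc sent_length.rep_eq words_eq_Nil_iff)+
    \<comment> \<open>If \<open>J\<close> or \<open>K\<close> is empty, one tensor term gives the
      coefficient and the other vanishes because of \<open>c0\<close>, even when both are empty.
      Otherwise \<open>series_one\<close> kills both terms and \<open>overlap_sum_log\<close>
      applies.\<close>
    then consider "J = 0" | "K = 0" | j k where
      "J \<noteq> 0" "K \<noteq> 0" "sent_length J = Suc j" "sent_length K = Suc k" by blast
    then show "series_coprod P (J, K)
        = series_add (series_tensor series_one P) (series_tensor P series_one) (J, K)"
    proof cases
      case 1
      then show ?thesis unfolding *
        by (simp add: series_add_def series_tensor_def series_one_def lookup_one c0 A0 P zero)
    next
      case 2
      then show ?thesis unfolding *
        by (simp add: series_add_def series_tensor_def series_one_def lookup_one c0 A0 P zero overlap_sum_0)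
    next
      case 3
      have "overlap_sum c (Suc j) (Suc k) = 0" unfolding c_def by (rule overlap_sum_log)
      with 3 show ?thesis unfolding *
        by (simp add: series_add_def series_tensor_def series_one_def lookup_one)
    qed
  qed
qed

end
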